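(* Let $|\Psi\rangle^{ABE}\in\mathcal{H}_A\otimes\mathcal{H}_B\otimes\mathcal{H}_E$ be a unit vector, and let $\rho^{ABE}=|\Psi\rangle\langle\Psi|$ be the corresponding tripartite pure state, with reduced states $\rho^{AB}$, $\rho^{EB}$, $\rho^B$. Then $$D(A|B)+J(E|B)=S(B),$$ where $D(A|B)$ is the quantum discord of $\rho^{AB}$ and $J(E|B)$ is the classical correlation of $\rho^{EB}$, both with measurement on $B$.
   Context: All Hilbert spaces are finite-dimensional complex Hilbert spaces. A state is a density operator (positive semidefinite, trace one). Superscripts denote reduced states. The von Neumann entropy is $S(X)=-\mathrm{Tr}\,\rho^X\log_2\rho^X$. For a bipartite state $\rho^{XB}$, the mutual information is $I(X:B)=S(X)+S(B)-S(XB)$. The classical correlation (with measurement on $B$) is $$J(X|B)=\max_{\{E_i^B\}}\Big(S(X)-\sum_i p_i\,S(X|E_i^B)\Big),$$ where the maximum is over all POVMs $\{E_i^B\}$ on $\mathcal{H}_B$, $p_i=\mathrm{Tr}\big((I\otimes E_i^B)\rho^{XB}\big)$, and $S(X|E_i^B)$ is the von Neumann entropy of the post-measurement state $\rho_i^X=\mathrm{Tr}_B\big((I\otimes E_i^B)\rho^{XB}\big)/p_i$ (terms with $p_i=0$ are omitted). The quantum discord (with measurement on $B$) is $D(X|B)=I(X:B)-J(X|B)$. *)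

theory Defs
  imports "HOL-Analysis.Analysis"
begin

text \<open>
  A finite-dimensional complex Hilbert space is represented, in an orthonormal basis indexed by
  a finite type \<open>'n\<close>, as \<open>complex ^ 'n\<close>; operators are square matrices. The tensor product of the
  spaces with index types \<open>'a\<close> and \<open>'b\<close> is the space with index type \<open>'a \<times> 'b\<close>.
\<close>

definition cadjoint :: "complex ^ 'n ^ 'n \<Rightarrow> complex ^ 'n ^ 'n" where
  "cadjoint A = (\<chi> i j. cnj (A $ j $ i))"

definition unitary_matrix :: "complex ^ 'n ^ 'n \<Rightarrow> bool" where
  "unitary_matrix U \<longleftrightarrow> cadjoint U ** U = mat 1 \<and> U ** cadjoint U = mat 1"

definition real_diag :: "('n \<Rightarrow> real) \<Rightarrow> complex ^ 'n ^ 'n" where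
  "real_diag d = (\<chi> i j. if i = j then complex_of_real (d i) else 0)"

definition psd :: "complex ^ 'n ^ 'n \<Rightarrow> bool" where
  "psd A \<longleftrightarrow> cadjoint A = A \<and> (\<forall>v. 0 \<le> Re (\<Sum>i\<in>UNIV. cnj (v $ i) * (A *v v) $ i))"

definition tensor_op ::
  "complex ^ 'x ^ 'x \<Rightarrow> complex ^ 'y ^ 'y \<Rightarrow>
   complex ^ ('x::finite \<times> 'y::finite) ^ ('x \<times> 'y)" where
  "tensor_op A B = (\<chi> p q. A $ fst p $ fst q * B $ snd p $ snd q)"

definition ptrace_fst ::
  "complex ^ ('x::finite \<times> 'y::finite) ^ ('x \<times> 'y) \<Rightarrow> complex ^ 'y ^ 'y" where
  "ptrace_fst M = (\<chi> y y'. \<Sum>x\<in>UNIV. M $ (x, y) $ (x, y'))"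

definition ptrace_snd ::
  "complex ^ ('x::finite \<times> 'y::finite) ^ ('x \<times> 'y) \<Rightarrow> complex ^ 'x ^ 'x" where
  "ptrace_snd M = (\<chi> x x'. \<Sum>y\<in>UNIV. M $ (x, y) $ (x', y))"

text \<open>
  Functional calculus for Hermitian matrices. The result does not depend on the
  diagonalisation \<open>A = U diag(d) U*\<close>, and one exists whenever \<open>A\<close> is Hermitian.
\<close>

definition fun_calc :: "(real \<Rightarrow> real) \<Rightarrow> complex ^ 'n ^ 'n \<Rightarrow> complex ^ 'n ^ 'n" where
  "fun_calc f A =
     (THE B. \<exists>U d. unitary_matrix U \<and> A = U ** real_diag d ** cadjoint U \<and>
                   B = U ** real_diag (\<lambda>i. f (d i)) ** cadjoint U)"

text \<open>
  The value of the logarithm at eigenvalue 0 is irrelevant, because it is multiplied by the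
  eigenvalue; this is the convention \<open>0 log 0 = 0\<close>.
\<close>

definition vn_entropy :: "complex ^ 'n ^ 'n \<Rightarrow> real" where
  "vn_entropy \<rho> = - Re (trace (\<rho> ** fun_calc (log 2) \<rho>))"

definition mutual_information ::
  "complex ^ ('x::finite \<times> 'b::finite) ^ ('x \<times> 'b) \<Rightarrow> real" where
  "mutual_information \<rho> = vn_entropy (ptrace_snd \<rho>) + vn_entropy (ptrace_fst \<rho>) - vn_entropy \<rho>"

text \<open>A POVM with \<open>n\<close> outcomes; only the values of \<open>E\<close> below \<open>n\<close> matter.\<close>

definition povm :: "nat \<Rightarrow> (nat \<Rightarrow> complex ^ 'b ^ 'b) \<Rightarrow> bool" where
  "povm n E \<longleftrightarrow> (\<forall>i<n. psd (E i)) \<and> (\<Sum>i<n. E i) = mat 1"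

definition outcome_prob ::
  "complex ^ ('x::finite \<times> 'b::finite) ^ ('x \<times> 'b) \<Rightarrow> complex ^ 'b ^ 'b \<Rightarrow> real" where
  "outcome_prob \<rho> F = Re (trace (tensor_op (mat 1) F ** \<rho>))"

definition post_state ::
  "complex ^ ('x::finite \<times> 'b::finite) ^ ('x \<times> 'b) \<Rightarrow> complex ^ 'b ^ 'b \<Rightarrow> complex ^ 'x ^ 'x" where
  "post_state \<rho> F = (1 / outcome_prob \<rho> F) *\<^sub>R ptrace_snd (tensor_op (mat 1) F ** \<rho>)"

text \<open>
  The second factor is the measured one, in the next two definitions as well.
  The maximum over the infinite set of POVMs is written as a supremum of reals.
\<close>

definition measurement_gain ::
  "complex ^ ('x::finite \<times> 'b::finite) ^ ('x \<times> 'b) \<Rightarrow> nat \<Rightarrow> (nat \<Rightarrow> complex ^ 'b ^ 'b) \<Rightarrow> real" where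
  "measurement_gain \<rho> n E =
     vn_entropy (ptrace_snd \<rho>) -
     (\<Sum>i | i < n \<and> outcome_prob \<rho> (E i) \<noteq> 0.
        outcome_prob \<rho> (E i) * vn_entropy (post_state \<rho> (E i)))"

definition classical_correlation ::
  "complex ^ ('x::finite \<times> 'b::finite) ^ ('x \<times> 'b) \<Rightarrow> real" where
  "classical_correlation \<rho> = Sup {measurement_gain \<rho> n E | n E. povm n E}"

definition discord ::
  "complex ^ ('x::finite \<times> 'b::finite) ^ ('x \<times> 'b) \<Rightarrow> real" where
  "discord \<rho> = mutual_information \<rho> - classical_correlation \<rho>"

definition pure_state :: "complex ^ 'n \<Rightarrow> complex ^ 'n ^ 'n" where
  "pure_state \<psi> = (\<chi> i j. \<psi> $ i * cnj (\<psi> $ j))"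

text \<open>
  Reductions of a tripartite operator, \<open>'a \<times> 'b \<times> 'e\<close> being the index type of the product of
  the spaces A, B, E. In the reduction to E and B the factors are reordered so that B is second.
\<close>

definition reduced_AB ::
  "complex ^ ('a::finite \<times> 'b::finite \<times> 'e::finite) ^ ('a \<times> 'b \<times> 'e) \<Rightarrow>
   complex ^ ('a \<times> 'b) ^ ('a \<times> 'b)" where
  "reduced_AB \<rho> = (\<chi> p q. \<Sum>e\<in>UNIV. \<rho> $ (fst p, snd p, e) $ (fst q, snd q, e))"

definition reduced_EB ::
  "complex ^ ('a::finite \<times> 'b::finite \<times> 'e::finite) ^ ('a \<times> 'b \<times> 'e) \<Rightarrow>
   complex ^ ('e \<times> 'b) ^ ('e \<times> 'b)" where
  "reduced_EB \<rho> = (\<chi> p q. \<Sum>a\<in>UNIV. \<rho> $ (a, snd p, fst p) $ (a, snd q, fst q))"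

definition reduced_B ::
  "complex ^ ('a::finite \<times> 'b::finite \<times> 'e::finite) ^ ('a \<times> 'b \<times> 'e) \<Rightarrow> complex ^ 'b ^ 'b" where
  "reduced_B \<rho> = (\<chi> b b'. \<Sum>a\<in>UNIV. \<Sum>e\<in>UNIV. \<rho> $ (a, b, e) $ (a, b', e))"

end

theory Submission
  imports Defs
begin

text \<open>
  Writing the post-measurement entropies as a sum of \<open>h(\<sigma>) = Tr \<sigma> \<cdot> S(\<sigma> / Tr \<sigma>)\<close> over unnormalised
  conditional states, superadditivity of \<open>h\<close> shows that rank-one POVMs suffice in the supremum. For
  these, the conditional states of \<open>A\<close> and of \<open>E\<close> are the marginals of one pure state and have equal
  entropy. Hence \<open>J(A|B) - S(A) = J(E|B) - S(E)\<close>, and the identity follows from \<open>S(AB) = S(E)\<close>.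
\<close>

text \<open>The supremum is never shown to be attained. Each POVM is refined, and the gain of the
  refinement on EB is compared with the gain of the original on AB. This gives one inequality;
  exchanging the roles of A and E gives the other. Refinement lengthens the list of outcomes, so it
  matters that POVMs of every finite length compete. The unnormalised conditional state is linear in
  the effect: refining an effect splits that state into a sum, and concavity of the entropy takes
  the form of superadditivity. A and E may differ in dimension, so a vector of their product is a
  rectangular matrix \<open>M\<close>, with marginals \<open>M ** adj M\<close> and
  \<open>transpose (adj M ** M)\<close>. Hence \<open>adj\<close> is defined for rectangular
  matrices, beside the square \<open>cadjoint\<close>. As \<open>fun_calc\<close> is a definite
  description, entropies become computable only through a diagonalisation, which is why a spectral
  theorem is proved on the way.\<close>

definition adj :: "complex ^ 'n ^ 'm \<Rightarrow> complex ^ 'm ^ 'n" where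
  "adj A = (\<chi> i j. cnj (A $ j $ i))"

lemma cadjoint_eq_adj: "cadjoint A = adj A"
  by (simp add: cadjoint_def adj_def)

lemma adj_mult: "adj (A ** B) = adj B ** adj A"
  by (simp add: adj_def matrix_matrix_mult_def vec_eq_iff mult.commute)

lemma adj_adj [simp]: "adj (adj A) = A"
  by (simp add: adj_def vec_eq_iff)

lemma adj_nth [simp]: "adj A $ i $ j = cnj (A $ j $ i)"
  by (simp add: adj_def)

lemma adj_sum: "adj (\<Sum>k\<in>K. A k) = (\<Sum>k\<in>K. adj (A k))"
  by (simp add: vec_eq_iff)

lemma matrix_mult_nth: "(A ** B) $ i $ j = (\<Sum>k\<in>UNIV. A $ i $ k * B $ k $ j)"
  by (simp add: matrix_matrix_mult_def)

lemma mult_real_diag_nth: "(A ** real_diag d) $ i $ j = A $ i $ j * d j"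
  by (simp add: matrix_mult_nth real_diag_def if_distrib[of "\<lambda>x. _ * x"] cong: if_cong)

lemma real_diag_mult_nth: "(real_diag d ** A) $ i $ j = d i * A $ i $ j"
  by (simp add: matrix_mult_nth real_diag_def if_distrib[of "\<lambda>x. x * _"] cong: if_cong)

lemma real_diag_nth: "real_diag d $ i $ j = (if i = j then of_real (d i) else 0)"
  by (simp add: real_diag_def)

lemma unitary_matrix_iff: "unitary_matrix U \<longleftrightarrow> adj U ** U = mat 1 \<and> U ** adj U = mat 1"
  by (simp add: unitary_matrix_def cadjoint_eq_adj)

lemma adj_mult_diagonalisation:
  assumes "unitary_matrix U" "A = U ** real_diag d ** adj U"
  shows "adj U ** A ** U = real_diag d"
proof -
  have "adj U ** A ** U = (adj U ** U) ** real_diag d ** (adj U ** U)"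
    by (simp add: assms(2) matrix_mul_assoc)
  then show ?thesis
    using assms(1) by (simp add: unitary_matrix_iff)
qed

section \<open>Functional calculus and entropy in terms of eigenvalues\<close>

definition diagonalisation :: "complex ^ 'n ^ 'n \<Rightarrow> complex ^ 'n ^ 'n \<Rightarrow> ('n \<Rightarrow> real) \<Rightarrow> bool" where
  "diagonalisation A U d \<longleftrightarrow> unitary_matrix U \<and> A = U ** real_diag d ** adj U"

text \<open>Two diagonalisations of the same matrix are related by \<open>W = adj V ** U\<close>,
  which intertwines the two diagonal matrices. Entrywise this says that \<open>W\<close> only links
  equal eigenvalues, so it also intertwines their images under \<open>f\<close>; this is the
  uniqueness behind the definite description.\<close>

lemma fun_calc_diagonalisation:
  assumes "diagonalisation A U d"
  shows "fun_calc f A = U ** real_diag (\<lambda>i. f (d i)) ** adj U"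
  unfolding fun_calc_def cadjoint_eq_adj
proof (rule the_equality)
  show "\<exists>U' d'. unitary_matrix U' \<and> A = U' ** real_diag d' ** adj U' \<and>
     U ** real_diag (\<lambda>i. f (d i)) ** adj U = U' ** real_diag (\<lambda>i. f (d' i)) ** adj U'"
    using assms unfolding diagonalisation_def by blast
next
  fix B
  assume "\<exists>V e. unitary_matrix V \<and> A = V ** real_diag e ** adj V \<and>
     B = V ** real_diag (\<lambda>i. f (e i)) ** adj V"
  then obtain V e where V: "unitary_matrix V" "A = V ** real_diag e ** adj V"
    and B: "B = V ** real_diag (\<lambda>i. f (e i)) ** adj V"
    by blast
  have U: "adj U ** U = mat 1" "U ** adj U = mat 1" "A = U ** real_diag d ** adj U"
    using assms by (auto simp: diagonalisation_def unitary_matrix_iff)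
  have V': "adj V ** V = mat 1" "V ** adj V = mat 1"
    using V by (auto simp: unitary_matrix_iff)
  define W where "W = adj V ** U"
  have "W ** real_diag d = adj V ** (U ** real_diag d ** adj U) ** U"
    using U by (simp add: W_def flip: matrix_mul_assoc)
  also have "\<dots> = adj V ** (V ** real_diag e ** adj V) ** U"
    using U(3) V(2) by simp
  also have "\<dots> = real_diag e ** W"
    using V' by (simp add: W_def matrix_mul_assoc)
  finally have "W $ i $ j * d j = e i * W $ i $ j" for i j
    by (metis mult_real_diag_nth real_diag_mult_nth)
  then have "W $ i $ j = 0 \<or> d j = e i" for i j
    by (metis mult.commute mult_cancel_left of_real_eq_iff)
  then have "W $ i $ j * f (d j) = f (e i) * W $ i $ j" for i j
    by (metis mult.commute mult_zero_left)
  then have *: "W ** real_diag (\<lambda>i. f (d i)) = real_diag (\<lambda>i. f (e i)) ** W"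
    by (simp add: vec_eq_iff mult_real_diag_nth real_diag_mult_nth)
  have "B = V ** (real_diag (\<lambda>i. f (e i)) ** W) ** adj U"
    using U by (simp add: B W_def flip: matrix_mul_assoc)
  also have "\<dots> = V ** (W ** real_diag (\<lambda>i. f (d i))) ** adj U"
    by (simp add: *)
  also have "\<dots> = U ** real_diag (\<lambda>i. f (d i)) ** adj U"
    using V' by (simp add: W_def matrix_mul_assoc)
  finally show "B = U ** real_diag (\<lambda>i. f (d i)) ** adj U" .
qed

lemma trace_diagonalisation:
  assumes "unitary_matrix U"
  shows "Re (trace (U ** real_diag d ** adj U)) = (\<Sum>i\<in>UNIV. d i)"
proof -
  have "trace (U ** real_diag d ** adj U) = trace (adj U ** U ** real_diag d)"
    by (metis trace_mul_sym matrix_mul_assoc)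
  also have "\<dots> = trace (real_diag d)"
    using assms by (simp add: unitary_matrix_iff)
  also have "\<dots> = of_real (\<Sum>i\<in>UNIV. d i)"
    by (simp add: trace_def real_diag_nth)
  finally show ?thesis by simp
qed

lemma vn_entropy_diagonalisation:
  assumes "diagonalisation A U d"
  shows "vn_entropy A = - (\<Sum>i\<in>UNIV. d i * log 2 (d i))"
proof -
  have U: "unitary_matrix U" "adj U ** U = mat 1" "A = U ** real_diag d ** adj U"
    using assms by (auto simp: diagonalisation_def unitary_matrix_iff)
  have "A ** fun_calc (log 2) A =
      U ** real_diag d ** (adj U ** U) ** real_diag (\<lambda>i. log 2 (d i)) ** adj U"
    unfolding fun_calc_diagonalisation[OF assms] by (subst U(3)) (simp add: matrix_mul_assoc)
  also have "\<dots> = U ** (real_diag d ** real_diag (\<lambda>i. log 2 (d i))) ** adj U"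
    by (simp add: U(2) matrix_mul_assoc)
  also have "real_diag d ** real_diag (\<lambda>i. log 2 (d i)) = real_diag (\<lambda>i. d i * log 2 (d i))"
    by (simp add: vec_eq_iff real_diag_mult_nth real_diag_nth)
  finally show ?thesis
    by (simp add: vn_entropy_def trace_diagonalisation[OF U(1)])
qed

lemma diagonalisation_scaleR:
  assumes "diagonalisation A U d"
  shows "diagonalisation (r *\<^sub>R A) U (\<lambda>i. r * d i)"
proof -
  have "U ** real_diag (\<lambda>i. r * d i) ** adj U = r *\<^sub>R (U ** real_diag d ** adj U)"
    by (simp add: vec_eq_iff matrix_mult_nth[of _ "adj U"] mult_real_diag_nth
        scaleR_conv_of_real[where 'a = complex] sum_distrib_left mult_ac)
  with assms show ?thesis
    by (simp add: diagonalisation_def)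
qed

text \<open>The transpose has the complex conjugate eigenvectors and the same eigenvalues. It is
  needed because the marginal of a vector on its second factor is a transposed Gram matrix.\<close>

lemma diagonalisation_transpose:
  assumes "diagonalisation A U d"
  shows "diagonalisation (transpose A) (transpose (adj U)) d"
proof -
  have V: "adj (transpose (adj U)) = transpose U"
    by (simp add: vec_eq_iff transpose_def)
  have "unitary_matrix (transpose (adj U))"
    using assms unfolding diagonalisation_def unitary_matrix_iff V
    by (simp add: transpose_mat flip: matrix_transpose_mul)
  moreover have "transpose (real_diag d) = real_diag d"
    by (auto simp: vec_eq_iff transpose_def real_diag_nth)
  ultimately show ?thesis
    using assms unfolding diagonalisation_def V
    by (simp add: matrix_transpose_mul matrix_mul_assoc)
qed

section \<open>Spectral theorem for Hermitian matrices\<close>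

lemma inner_complex_vec: "(x :: complex ^ 'n) \<bullet> y = Re (\<Sum>i\<in>UNIV. cnj (x $ i) * y $ i)"
  by (simp add: inner_vec_def inner_complex_def)

text \<open>Together with the preceding lemma, this expresses complex orthogonality to
  \<open>x\<close> as real orthogonality to both \<open>x\<close> and \<open>\<i> *s x\<close>, so
  that real Euclidean geometry applies.\<close>

lemma inner_imaginary_complex_vec:
  "(\<i> *s x :: complex ^ 'n) \<bullet> y = Im (\<Sum>i\<in>UNIV. cnj (x $ i) * y $ i)"
  by (simp add: inner_vec_def inner_complex_def algebra_simps sum_subtractf)

lemma cnj_inner_adj:
  fixes A :: "complex ^ 'n ^ 'm"
  shows "(\<Sum>i\<in>UNIV. cnj (x $ i) * (A *v y) $ i) = (\<Sum>j\<in>UNIV. cnj ((adj A *v x) $ j) * y $ j)"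
proof -
  have "(\<Sum>i\<in>UNIV. cnj (x $ i) * (A *v y) $ i) = (\<Sum>i\<in>UNIV. \<Sum>j\<in>UNIV. cnj (x $ i) * A $ i $ j * y $ j)"
    by (simp add: matrix_vector_mult_def sum_distrib_left mult_ac)
  also have "\<dots> = (\<Sum>j\<in>UNIV. \<Sum>i\<in>UNIV. cnj (x $ i) * A $ i $ j * y $ j)"
    by (rule sum.swap)
  also have "\<dots> = (\<Sum>j\<in>UNIV. cnj ((adj A *v x) $ j) * y $ j)"
    by (simp add: matrix_vector_mult_def sum_distrib_left sum_distrib_right mult_ac)
  finally show ?thesis .
qed

text \<open>
  A maximiser \<open>x\<close> of the Rayleigh quotient on an invariant subspace is an eigenvector: the form
  \<open>m \<parallel>z\<parallel>\<^sup>2 - z \<bullet> A z\<close> is nonnegative there and vanishes at \<open>x\<close>, hence so does its polar form with \<open>x\<close>.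
\<close>

lemma selfadjoint_eigenvector_in_subspace:
  fixes f :: "'v::euclidean_space \<Rightarrow> 'v"
  assumes f: "linear f" and sym: "\<And>x y. f x \<bullet> y = x \<bullet> f y"
    and W: "subspace W" and inv: "\<And>x. x \<in> W \<Longrightarrow> f x \<in> W" and ne: "\<exists>x\<in>W. x \<noteq> 0"
  shows "\<exists>x\<in>W. norm x = 1 \<and> (\<exists>m. f x = m *\<^sub>R x)"
proof -
  let ?S = "W \<inter> sphere 0 1"
  obtain z where z: "z \<in> W" "z \<noteq> 0"
    using ne by blast
  have "z /\<^sub>R norm z \<in> ?S"
    using z W by (simp add: subspace_scale)
  then have "?S \<noteq> {}" by blast
  moreover have "compact ?S"
    using closed_subspace[OF W] by (intro closed_Int_compact) auto
  moreover have "continuous_on ?S (\<lambda>x. x \<bullet> f x)"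
    using f by (intro continuous_intros linear_continuous_on) (simp add: linear_conv_bounded_linear)
  ultimately obtain x where "x \<in> ?S" and max: "\<And>y. y \<in> ?S \<Longrightarrow> y \<bullet> f y \<le> x \<bullet> f x"
    using continuous_attains_sup[of ?S "\<lambda>x. x \<bullet> f x"] by blast
  then have x: "x \<in> W" "norm x = 1"
    by auto
  define m where "m = x \<bullet> f x"
  define b where "b u v = m * (u \<bullet> v) - u \<bullet> f v" for u v
  have b_nonneg: "0 \<le> b y y" if "y \<in> W" for y
  proof (cases "y = 0")
    case False
    have "(y /\<^sub>R norm y) \<bullet> f (y /\<^sub>R norm y) \<le> m"
      unfolding m_def using that W False by (intro max) (simp add: subspace_scale)
    then have "(y \<bullet> f y) / (norm y)\<^sup>2 \<le> m"
      by (simp add: linear_scale[OF f] power2_eq_square divide_simps)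
    then show ?thesis
      using False by (simp add: b_def divide_simps power2_norm_eq_inner split: if_splits)
  qed (simp add: b_def linear_0[OF f])
  \<comment> \<open>The residual of the eigenvector equation. It also represents the linear form
    \<open>b x\<close>, so testing that form on \<open>y\<close> yields the squared norm of
    \<open>y\<close>.\<close>
  define y where "y = m *\<^sub>R x - f x"
  have y: "y \<in> W"
    using x inv W by (simp add: y_def subspace_diff subspace_scale)
  have bxx: "b x x = 0"
    using x by (simp add: b_def m_def dot_square_norm)
  have "b x y = (m *\<^sub>R x - f x) \<bullet> y"
    using sym[of x y] by (simp add: b_def inner_diff_left)
  then have bxy: "b x y = y \<bullet> y"
    by (fold y_def)
  have quad: "0 \<le> 2 * t * (y \<bullet> y) + t\<^sup>2 * b y y" for t
  proof -
    have "b y x = b x y"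
      using sym[of y x] by (simp add: b_def inner_commute)
    moreover have "b (x + t *\<^sub>R y) (x + t *\<^sub>R y) = b x x + t * b x y + t * b y x + t\<^sup>2 * b y y"
      by (simp add: b_def linear_add[OF f] linear_scale[OF f] inner_add_left inner_add_right
          algebra_simps power2_eq_square)
    moreover have "0 \<le> b (x + t *\<^sub>R y) (x + t *\<^sub>R y)"
      using x y W by (intro b_nonneg) (simp add: subspace_add subspace_scale)
    ultimately show ?thesis
      using bxx bxy by simp
  qed
  have "y \<bullet> y = 0"
  proof (rule ccontr)
    assume "y \<bullet> y \<noteq> 0"
    then have pos: "0 < y \<bullet> y" by (simp add: less_le)
    \<comment> \<open>A step small enough that the linear term wins: \<open>s * b y y\<close> stays
      below \<open>y \<bullet> y\<close>, so the quadratic would be negative at \<open>- s\<close>.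
      The summand 1 keeps the denominator positive.\<close>
    define s where "s = (y \<bullet> y) / (1 + b y y)"
    have B: "0 \<le> b y y" using b_nonneg y by blast
    have s: "0 < s" "s * (1 + b y y) = y \<bullet> y"
      using pos B by (auto simp: s_def)
    have "0 \<le> s * (s * b y y - 2 * (y \<bullet> y))"
      using quad[of "- s"] by (simp add: algebra_simps power2_eq_square)
    then have "2 * (y \<bullet> y) \<le> s * b y y"
      using s by (simp add: zero_le_mult_iff)
    then show False
      using s pos by (simp add: algebra_simps)
  qed
  then have "f x = m *\<^sub>R x"
    by (simp add: y_def)
  then show ?thesis
    using x by blast
qed

text \<open>Induction on a set of column indices: the orthogonal complement of the eigenvectors
  found so far is invariant because \<open>A\<close> is self-adjoint and their eigenvalues are real,
  so it contains a further eigenvector. Indexing by a subset of \<open>'n\<close> bounds how many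
  have been used.\<close>

lemma hermitian_orthonormal_eigenvectors:
  fixes A :: "complex ^ 'n ^ 'n"
  assumes A: "adj A = A" and "finite I"
  shows "\<exists>u d. \<forall>i\<in>I. A *v u i = complex_of_real (d i) *s u i \<and>
     (\<forall>j\<in>I. (\<Sum>k\<in>UNIV. cnj (u i $ k) * u j $ k) = (if i = (j :: 'n) then 1 else 0))"
  using \<open>finite I\<close>
proof (induction I)
  case (insert j I)
  let ?ip = "\<lambda>x y :: complex ^ 'n. \<Sum>k\<in>UNIV. cnj (x $ k) * y $ k"
  obtain u d where eig: "\<And>i. i \<in> I \<Longrightarrow> A *v u i = complex_of_real (d i) *s u i"
    and orth: "\<And>i j. i \<in> I \<Longrightarrow> j \<in> I \<Longrightarrow> ?ip (u i) (u j) = (if i = j then 1 else 0)"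
    using insert.IH by blast
  define S where "S = u ` I \<union> (\<lambda>i. \<i> *s u i) ` I"
  define W where "W = {x. \<forall>i\<in>I. ?ip (u i) x = 0}"
  have W_iff: "x \<in> W \<longleftrightarrow> (\<forall>s\<in>S. s \<bullet> x = 0)" for x
  proof -
    have "?ip y x = 0 \<longleftrightarrow> y \<bullet> x = 0 \<and> (\<i> *s y) \<bullet> x = 0" for y
      by (simp only: inner_imaginary_complex_vec inner_complex_vec[of y] complex_eq_iff zero_complex.sel)
    then show ?thesis
      unfolding W_def S_def by blast
  qed
  have "subspace W"
    by (auto simp: subspace_def W_iff inner_add_right)
  moreover have "A *v x \<in> W" if "x \<in> W" for x
  proof -
    have "?ip (u i) (A *v x) = of_real (d i) * ?ip (u i) x" if "i \<in> I" for i
      using cnj_inner_adj[of "u i" A x] eig[OF that] A by (simp add: sum_distrib_left mult_ac)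
    with that show ?thesis
      by (simp add: W_def)
  qed
  moreover have "\<exists>x\<in>W. x \<noteq> 0"
  proof -
    \<comment> \<open>The index \<open>j\<close> is still free, so fewer than
      \<open>CARD('n)\<close> eigenvectors have been chosen. Each contributes two real directions to
      \<open>S\<close>, against a real dimension of twice \<open>CARD('n)\<close>.\<close>
    have "card (insert j I) \<le> CARD('n)"
      by (rule card_mono) auto
    then have "card I < CARD('n)"
      using insert.hyps by simp
    have "dim S \<le> card S"
      using insert.hyps by (intro dim_le_card') (auto simp: S_def)
    also have "card S \<le> card (u ` I) + card ((\<lambda>i. \<i> *s u i) ` I)"
      unfolding S_def by (rule card_Un_le)
    also have "\<dots> \<le> card I + card I"
      using insert.hyps by (intro add_mono card_image_le) auto
    also have "\<dots> < DIM(complex ^ 'n)"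
      using \<open>card I < CARD('n)\<close> by simp
    finally have "dim S < DIM(complex ^ 'n)" .
    then obtain x where "x \<noteq> 0" "\<And>y. y \<in> span S \<Longrightarrow> orthogonal x y"
      using orthogonal_to_subspace_exists by blast
    then have "x \<in> W"
      by (auto simp: W_iff orthogonal_def inner_commute span_base)
    with \<open>x \<noteq> 0\<close> show ?thesis by blast
  qed
  moreover have "linear ((*v) A)"
    by (auto intro!: linearI simp: matrix_vector_right_distrib scaleR_conv_of_real vec_eq_iff
         matrix_vector_mult_def sum_distrib_left mult_ac)
  moreover have "(A *v x) \<bullet> y = x \<bullet> (A *v y)" for x y
    using cnj_inner_adj[of x A y] A by (simp add: inner_complex_vec del: Re_sum)
  ultimately obtain x m where x: "x \<in> W" "norm x = 1" "A *v x = m *\<^sub>R x"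
    using selfadjoint_eigenvector_in_subspace[of "(*v) A" W] by blast
  have xx: "?ip x x = 1"
  proof -
    have "?ip x x = of_real (x \<bullet> x)"
      by (simp add: inner_vec_def inner_complex_def complex_eq_iff mult.commute)
    then show ?thesis
      using x by (simp add: dot_square_norm)
  qed
  have ux: "?ip (u i) x = 0" if "i \<in> I" for i
    using x that by (simp add: W_def)
  have xu: "?ip x (u i) = 0" if "i \<in> I" for i
  proof -
    have "?ip x (u i) = cnj (?ip (u i) x)" by (simp add: mult.commute)
    then show ?thesis by (simp only: ux[OF that] complex_cnj_zero)
  qed
  show ?case
  proof (intro exI ballI conjI)
    fix i assume i: "i \<in> insert j I"
    show "A *v (u(j := x)) i = complex_of_real ((d(j := m)) i) *s (u(j := x)) i"
      using i eig x(3) by (auto simp: vec_eq_iff scaleR_conv_of_real[where 'a = complex])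
    fix l assume l: "l \<in> insert j I"
    show "?ip ((u(j := x)) i) ((u(j := x)) l) = (if i = l then 1 else 0)"
      using i l insert.hyps orth xx ux xu by auto
  qed
qed auto

lemma hermitian_diagonalisation:
  fixes A :: "complex ^ 'n ^ 'n"
  assumes "adj A = A"
  obtains U d where "diagonalisation A U d"
proof -
  obtain u :: "'n \<Rightarrow> complex ^ 'n" and d where ud: "\<forall>i. A *v u i = complex_of_real (d i) *s u i \<and>
      (\<forall>j. (\<Sum>k\<in>UNIV. cnj (u i $ k) * u j $ k) = (if i = j then 1 else 0))"
    using hermitian_orthonormal_eigenvectors[OF assms, of UNIV] by auto
  then have eig: "\<And>i. A *v u i = complex_of_real (d i) *s u i"
    and orth: "\<And>i j. (\<Sum>k\<in>UNIV. cnj (u i $ k) * u j $ k) = (if i = j then 1 else 0)"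
    by blast+
  define U where "U = (\<chi> i j. u j $ i)"
  have U: "adj U ** U = mat 1"
    by (simp add: vec_eq_iff matrix_mult_nth U_def orth mat_def)
  then have U': "U ** adj U = mat 1"
    by (simp add: matrix_left_right_inverse)
  have "(A ** U) $ i $ j = (U ** real_diag d) $ i $ j" for i j
  proof -
    have "(A ** U) $ i $ j = (A *v u j) $ i"
      by (simp add: matrix_mult_nth matrix_vector_mult_def U_def)
    then show ?thesis
      by (simp add: eig mult_real_diag_nth U_def)
  qed
  then have "A ** U = U ** real_diag d"
    by (simp add: vec_eq_iff)
  then have "A = U ** real_diag d ** adj U"
    by (metis U' matrix_mul_assoc matrix_mul_rid)
  then show thesis
    using that U U' by (auto simp: diagonalisation_def unitary_matrix_iff)
qed


section \<open>Positive semidefinite matrices and changes of basis\<close>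

lemma psd_gram: "psd (M ** adj M)"
proof -
  have "Re (\<Sum>i\<in>UNIV. cnj (v $ i) * ((M ** adj M) *v v) $ i) = (adj M *v v) \<bullet> (adj M *v v)" for v
    using cnj_inner_adj[of v M "adj M *v v"]
    by (simp add: matrix_vector_mul_assoc inner_complex_vec del: Re_sum)
  then show ?thesis
    by (simp add: psd_def cadjoint_eq_adj adj_mult del: Re_sum)
qed

lemma psd_sum:
  assumes "\<And>k. k \<in> K \<Longrightarrow> psd (A k)"
  shows "psd (\<Sum>k\<in>K. A k)"
proof -
  have "(\<Sum>i\<in>UNIV. cnj (v $ i) * ((\<Sum>k\<in>K. A k) *v v) $ i) =
      (\<Sum>k\<in>K. \<Sum>i\<in>UNIV. cnj (v $ i) * (A k *v v) $ i)" for v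
  proof -
    have "((\<Sum>k\<in>K. A k) *v v) $ i = (\<Sum>k\<in>K. (A k *v v) $ i)" for i
      by (simp add: matrix_vector_mult_def sum_distrib_right sum.swap[of _ K])
    then show ?thesis
      by (simp add: sum_distrib_left sum.swap[of _ K])
  qed
  then show ?thesis
    using assms by (auto simp: psd_def cadjoint_eq_adj adj_sum Re_sum[of _ K] intro!: sum_nonneg simp del: Re_sum)
qed

text \<open>The diagonal of \<open>A\<close> in another orthonormal basis is an average of its
  eigenvalues. The weights form a doubly stochastic matrix when \<open>U\<close> is unitary too, by
  the row and column norms below.\<close>

lemma diagonal_change_of_basis:
  assumes "diagonalisation A V e"
  shows "Re ((adj U ** A ** U) $ i $ i) = (\<Sum>j\<in>UNIV. (cmod ((adj U ** V) $ i $ j))\<^sup>2 * e j)"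
proof -
  let ?W = "adj U ** V"
  have "adj U ** A ** U = ?W ** real_diag e ** adj ?W"
    using assms by (simp add: diagonalisation_def adj_mult matrix_mul_assoc)
  then have "(adj U ** A ** U) $ i $ i = (\<Sum>j\<in>UNIV. of_real ((cmod (?W $ i $ j))\<^sup>2 * e j))"
    by (simp add: matrix_mult_nth[of _ "adj ?W"] mult_real_diag_nth complex_norm_square mult_ac
        del: of_real_power)
  then show ?thesis
    by simp
qed

lemma unitary_matrix_row_norm:
  assumes "unitary_matrix W"
  shows "(\<Sum>j\<in>UNIV. (cmod (W $ i $ j))\<^sup>2) = 1"
proof -
  have "complex_of_real (\<Sum>j\<in>UNIV. (cmod (W $ i $ j))\<^sup>2) = (W ** adj W) $ i $ i"
    by (simp add: matrix_mult_nth complex_norm_square del: of_real_power)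
  also have "\<dots> = 1"
    using assms by (simp add: unitary_matrix_iff mat_def)
  finally show ?thesis
    using of_real_eq_1_iff by blast
qed

lemma unitary_matrix_adj: "unitary_matrix W \<Longrightarrow> unitary_matrix (adj W)"
  by (simp add: unitary_matrix_iff)

lemma unitary_matrix_column_norm:
  assumes "unitary_matrix W"
  shows "(\<Sum>i\<in>UNIV. (cmod (W $ i $ j))\<^sup>2) = 1"
  using unitary_matrix_row_norm[OF unitary_matrix_adj[OF assms], of j] by simp

lemma unitary_matrix_adj_mult:
  assumes "unitary_matrix U" "unitary_matrix V"
  shows "unitary_matrix (adj U ** V)"
proof -
  have "adj V ** (U ** adj U) ** V = mat 1" "adj U ** (V ** adj V) ** U = mat 1"
    using assms by (simp_all add: unitary_matrix_iff)
  then show ?thesis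
    by (simp add: unitary_matrix_iff adj_mult matrix_mul_assoc)
qed

lemma psd_diagonalisation:
  assumes "psd A"
  obtains U d where "diagonalisation A U d" "\<And>i. 0 \<le> d i"
proof -
  obtain U d where Ud: "diagonalisation A U d"
    using assms hermitian_diagonalisation by (auto simp: psd_def cadjoint_eq_adj)
  have "0 \<le> d i" for i
  proof -
    have "complex_of_real (d i) = (adj U ** A ** U) $ i $ i"
      using Ud adj_mult_diagonalisation[of U A d] by (simp add: diagonalisation_def real_diag_nth)
    also have "\<dots> = (\<Sum>k\<in>UNIV. cnj (column i U $ k) * (A *v column i U) $ k)"
      by (simp add: matrix_mult_nth matrix_vector_mult_def column_def flip: matrix_mul_assoc)
    finally have "complex_of_real (d i) = \<dots>" .
    then have "d i = Re (\<Sum>k\<in>UNIV. cnj (column i U $ k) * (A *v column i U) $ k)"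
      by (metis Re_complex_of_real)
    then show ?thesis
      using assms by (simp add: psd_def)
  qed
  with Ud that show thesis by blast
qed

section \<open>Homogeneous entropy and its superadditivity\<close>

definition weighted_entropy :: "complex ^ 'n ^ 'n \<Rightarrow> real" where
  "weighted_entropy A = Re (trace A) * vn_entropy ((1 / Re (trace A)) *\<^sub>R A)"

lemma weighted_entropy_diagonalisation:
  assumes "diagonalisation A U d" and nonneg: "\<And>i. 0 \<le> d i"
  shows "weighted_entropy A = - (\<Sum>i\<in>UNIV. d i * log 2 (d i / sum d UNIV))"
proof -
  have tr: "Re (trace A) = sum d UNIV"
    using assms(1) trace_diagonalisation by (auto simp: diagonalisation_def)
  show ?thesis
  proof (cases "sum d UNIV = 0")
    case True
    then have "d i = 0" for i
      using nonneg by (simp add: sum_nonneg_eq_0_iff)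
    with True show ?thesis
      by (simp add: weighted_entropy_def tr)
  next
    case False
    then show ?thesis
      by (simp add: weighted_entropy_def tr sum_distrib_left
          vn_entropy_diagonalisation[OF diagonalisation_scaleR[OF assms(1)]])
  qed
qed

lemma weighted_entropy_nonneg:
  assumes "psd A"
  shows "0 \<le> weighted_entropy A"
proof -
  obtain U d where Ud: "diagonalisation A U d" "\<And>i. 0 \<le> d i"
    using psd_diagonalisation[OF assms] by blast
  have "d i * log 2 (d i / sum d UNIV) \<le> 0" for i
  proof (cases "d i = 0")
    case False
    have "d i \<le> sum d UNIV"
      using Ud(2) by (intro member_le_sum) auto
    moreover have "0 < d i"
      using False Ud(2)[of i] by simp
    ultimately show ?thesis
      by (intro mult_nonneg_nonpos) auto
  qed simp
  then show ?thesis
    by (simp add: weighted_entropy_diagonalisation[OF Ud] sum_nonpos)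
qed

text \<open>Nonnegativity of a relative entropy. On triples \<open>(k, i, j)\<close> compare the
  weights \<open>w k i j * e k j\<close> and \<open>w k i j * p k * d i / P\<close>: column sums
  give the first total mass \<open>P\<close>, row sums give the same for the second, and the
  logarithm of their ratio splits into the two sides of the claim.\<close>

lemma log_sum_inequality:
  fixes w :: "'k \<Rightarrow> 'n::finite \<Rightarrow> 'n \<Rightarrow> real"
  assumes K: "finite K" and w: "\<And>k i j. 0 \<le> w k i j" and e: "\<And>k j. k \<in> K \<Longrightarrow> 0 \<le> e k j"
    and rows: "\<And>k i. k \<in> K \<Longrightarrow> (\<Sum>j\<in>UNIV. w k i j) = 1"
    and cols: "\<And>k j. k \<in> K \<Longrightarrow> (\<Sum>i\<in>UNIV. w k i j) = 1"
    and d: "\<And>i. d i = (\<Sum>k\<in>K. \<Sum>j\<in>UNIV. w k i j * e k j)"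
  shows "(\<Sum>i\<in>UNIV. d i * ln (d i / sum d UNIV))
           \<le> (\<Sum>k\<in>K. \<Sum>j\<in>UNIV. e k j * ln (e k j / sum (e k) UNIV))"
proof -
  define p where "p k = sum (e k) UNIV" for k
  define P where "P = sum d UNIV"
  have collapse: "(\<Sum>i\<in>UNIV. \<Sum>j\<in>UNIV. w k i j * x j) = sum x UNIV" if "k \<in> K" for k x
  proof -
    have "(\<Sum>i\<in>UNIV. \<Sum>j\<in>UNIV. w k i j * x j) = (\<Sum>j\<in>UNIV. (\<Sum>i\<in>UNIV. w k i j) * x j)"
      by (subst sum.swap) (simp add: sum_distrib_right)
    then show ?thesis
      using cols[OF that] by simp
  qed
  have P: "P = sum p K"
    unfolding P_def p_def d by (subst sum.swap) (simp add: collapse)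
  have d_nonneg: "0 \<le> d i" for i
    unfolding d using w e by (intro sum_nonneg mult_nonneg_nonneg)
  have p_nonneg: "0 \<le> p k" if "k \<in> K" for k
    unfolding p_def using e[OF that] by (intro sum_nonneg)
  have gibbs: "w k i j * (e k j - p k * (d i / P))
      \<le> w k i j * e k j * (ln (e k j / p k) - ln (d i / P))" if k: "k \<in> K" for k i j
  proof (cases "w k i j * e k j = 0")
    case True
    have "0 \<le> w k i j * (p k * (d i / P))"
      using w p_nonneg[OF k] d_nonneg p_nonneg by (intro mult_nonneg_nonneg divide_nonneg_nonneg) (auto simp: P sum_nonneg)
    with True show ?thesis
      by (simp only: right_diff_distrib)
  next
    case False
    then have pos: "0 < w k i j" "0 < e k j"
      using w[of k i j] e[OF k, of j] by auto
    have "e k j \<le> p k"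
      unfolding p_def using e[OF k] by (intro member_le_sum) auto
    with pos have "0 < p k" by simp
    have "p k \<le> P"
      unfolding P using p_nonneg k K by (intro member_le_sum) auto
    with \<open>0 < p k\<close> have "0 < P" by simp
    \<comment> \<open>The weight of this triple is one of the summands of \<open>d i\<close>, so
      \<open>d i\<close> is positive and every logarithm below has a positive argument.\<close>
    have "w k i j * e k j \<le> (\<Sum>j\<in>UNIV. w k i j * e k j)"
      using w e[OF k] by (intro member_le_sum) auto
    also have "\<dots> \<le> d i"
      unfolding d using w e k K
      by (intro member_le_sum[where f = "\<lambda>k. \<Sum>j\<in>UNIV. w k i j * e k j"] sum_nonneg mult_nonneg_nonneg) auto
    finally have "0 < d i"
      using pos by (smt (verit) mult_pos_pos)
    let ?t = "(d i / P) / (e k j / p k)"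
    have "ln ?t \<le> ?t - 1"
      using pos \<open>0 < p k\<close> \<open>0 < P\<close> \<open>0 < d i\<close> by (intro ln_le_minus_one) auto
    moreover have "ln ?t = ln (d i / P) - ln (e k j / p k)"
      using pos \<open>0 < p k\<close> \<open>0 < P\<close> \<open>0 < d i\<close> by (intro ln_divide_pos) auto
    ultimately have "1 - ?t \<le> ln (e k j / p k) - ln (d i / P)"
      by linarith
    then have "(w k i j * e k j) * (1 - ?t) \<le> w k i j * e k j * (ln (e k j / p k) - ln (d i / P))"
      using pos by (intro mult_left_mono) auto
    moreover have "(w k i j * e k j) * (1 - ?t) = w k i j * (e k j - p k * (d i / P))"
      using pos \<open>0 < p k\<close> \<open>0 < P\<close> by (simp add: field_simps)
    ultimately show ?thesis
      by (simp only:)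
  qed
  \<comment> \<open>The two weights have equal total mass, so the pointwise lower bounds add up to
    0. For \<open>P = 0\<close> division by zero removes the second term, and the first sums to
    \<open>P\<close>.\<close>
  have "0 = (\<Sum>k\<in>K. p k - p k * (\<Sum>i\<in>UNIV. d i / P))"
  proof (cases "P = 0")
    case True
    then show ?thesis by (simp add: P)
  next
    case False
    then show ?thesis
      by (simp add: P_def flip: sum_divide_distrib)
  qed
  also have "\<dots> = (\<Sum>k\<in>K. \<Sum>i\<in>UNIV. \<Sum>j\<in>UNIV. w k i j * (e k j - p k * (d i / P)))"
  proof (rule sum.cong[OF refl])
    fix k assume k: "k \<in> K"
    have "(\<Sum>i\<in>UNIV. \<Sum>j\<in>UNIV. w k i j * (e k j - p k * (d i / P))) =
        (\<Sum>i\<in>UNIV. \<Sum>j\<in>UNIV. w k i j * e k j) - (\<Sum>i\<in>UNIV. (\<Sum>j\<in>UNIV. w k i j) * (p k * (d i / P)))"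
      by (simp only: right_diff_distrib sum_subtractf sum_distrib_right)
    also have "\<dots> = p k - p k * (\<Sum>i\<in>UNIV. d i / P)"
      by (simp only: collapse[OF k] rows[OF k] p_def sum_distrib_left mult_1)
    finally show "p k - p k * (\<Sum>i\<in>UNIV. d i / P) =
        (\<Sum>i\<in>UNIV. \<Sum>j\<in>UNIV. w k i j * (e k j - p k * (d i / P)))" by simp
  qed
  also have "\<dots> \<le> (\<Sum>k\<in>K. \<Sum>i\<in>UNIV. \<Sum>j\<in>UNIV. w k i j * e k j * (ln (e k j / p k) - ln (d i / P)))"
    by (intro sum_mono gibbs)
  also have "\<dots> = (\<Sum>k\<in>K. \<Sum>i\<in>UNIV. \<Sum>j\<in>UNIV. w k i j * (e k j * ln (e k j / p k))) -
      (\<Sum>k\<in>K. \<Sum>i\<in>UNIV. \<Sum>j\<in>UNIV. w k i j * e k j * ln (d i / P))"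
    by (simp add: right_diff_distrib sum_subtractf mult.assoc)
  also have "(\<Sum>k\<in>K. \<Sum>i\<in>UNIV. \<Sum>j\<in>UNIV. w k i j * (e k j * ln (e k j / p k))) =
      (\<Sum>k\<in>K. \<Sum>j\<in>UNIV. e k j * ln (e k j / p k))"
    by (simp add: collapse)
  also have "(\<Sum>k\<in>K. \<Sum>i\<in>UNIV. \<Sum>j\<in>UNIV. w k i j * e k j * ln (d i / P)) = (\<Sum>i\<in>UNIV. d i * ln (d i / P))"
    by (subst sum.swap) (simp add: d sum_distrib_right)
  finally show ?thesis
    by (simp add: p_def P_def)
qed

text \<open>In an eigenbasis of the sum, each eigenvalue of the sum is a sum of diagonal entries of
  the \<open>A k\<close>, and these are doubly stochastic averages of the eigenvalues of
  \<open>A k\<close>. The matrix statement thus reduces to the scalar inequality, although the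
  \<open>A k\<close> need not commute.\<close>

lemma weighted_entropy_superadditive:
  assumes K: "finite K" and psd: "\<And>k. k \<in> K \<Longrightarrow> psd (A k)"
  shows "(\<Sum>k\<in>K. weighted_entropy (A k)) \<le> weighted_entropy (\<Sum>k\<in>K. A k)"
proof -
  obtain U d where Ud: "diagonalisation (\<Sum>k\<in>K. A k) U d" "\<And>i. 0 \<le> d i"
    using psd_diagonalisation[OF psd_sum] psd by metis
  have "\<forall>k\<in>K. \<exists>V e. diagonalisation (A k) V e \<and> (\<forall>i. 0 \<le> e i)"
    using psd psd_diagonalisation by metis
  then obtain V e where Ve: "\<And>k. k \<in> K \<Longrightarrow> diagonalisation (A k) (V k) (e k)"
    and e: "\<And>k i. k \<in> K \<Longrightarrow> 0 \<le> e k i"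
    by metis
  define w where "w k i j = (cmod ((adj U ** V k) $ i $ j))\<^sup>2" for k i j
  have unitary: "unitary_matrix (adj U ** V k)" if "k \<in> K" for k
    using Ud(1) Ve[OF that] by (intro unitary_matrix_adj_mult) (auto simp: diagonalisation_def)
  have "d i = (\<Sum>k\<in>K. \<Sum>j\<in>UNIV. w k i j * e k j)" for i
  proof -
    have "d i = Re ((adj U ** (\<Sum>k\<in>K. A k) ** U) $ i $ i)"
      using Ud(1) adj_mult_diagonalisation[of U "\<Sum>k\<in>K. A k" d]
      by (simp add: diagonalisation_def real_diag_nth)
    also have "adj U ** (\<Sum>k\<in>K. A k) ** U = (\<Sum>k\<in>K. adj U ** A k ** U)"
      by (simp add: vec_eq_iff matrix_mult_nth sum_distrib_left sum_distrib_right sum.swap[of _ K])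
    finally show ?thesis
      by (simp add: diagonal_change_of_basis[OF Ve] w_def)
  qed
  then have "(\<Sum>i\<in>UNIV. d i * ln (d i / sum d UNIV))
      \<le> (\<Sum>k\<in>K. \<Sum>j\<in>UNIV. e k j * ln (e k j / sum (e k) UNIV))"
    using unitary by (intro log_sum_inequality[OF K, where w = w])
      (auto simp: w_def e unitary_matrix_row_norm unitary_matrix_column_norm)
  then have "(\<Sum>i\<in>UNIV. d i * log 2 (d i / sum d UNIV))
      \<le> (\<Sum>k\<in>K. \<Sum>j\<in>UNIV. e k j * log 2 (e k j / sum (e k) UNIV))"
    by (simp add: log_def divide_right_mono flip: sum_divide_distrib)
  then show ?thesis
    using e by (simp add: weighted_entropy_diagonalisation[OF Ud] weighted_entropy_diagonalisation[OF Ve] sum_negf)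
qed

section \<open>Equality of the entropies of the two marginals of a pure vector\<close>

text \<open>
  With \<open>W = U\<^sup>* M V\<close> both Gram matrices become diagonal, so \<open>W\<close> only links equal eigenvalues and
  \<open>\<bar>W i j\<bar>\<^sup>2\<close> is a coupling of the two spectra. This avoids the Schmidt decomposition.
\<close>

lemma gram_spectra:
  fixes M :: "complex ^ 'n ^ 'm"
  assumes "diagonalisation (M ** adj M) U d" "diagonalisation (adj M ** M) V e"
  shows "(\<Sum>i\<in>UNIV. d i * g (d i)) = (\<Sum>j\<in>UNIV. e j * g (e j))"
proof -
  have U: "unitary_matrix U" "U ** adj U = mat 1" "M ** adj M = U ** real_diag d ** adj U"
    and V: "unitary_matrix V" "V ** adj V = mat 1" "adj M ** M = V ** real_diag e ** adj V"
    using assms by (auto simp: diagonalisation_def unitary_matrix_iff)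
  define W where "W = adj U ** M ** V"
  have "W ** adj W = adj U ** M ** (V ** adj V) ** adj M ** U"
    by (simp add: W_def adj_mult matrix_mul_assoc)
  also have "\<dots> = adj U ** (M ** adj M) ** U"
    by (simp add: V(2) matrix_mul_assoc)
  also have "\<dots> = real_diag d"
    by (rule adj_mult_diagonalisation[OF U(1,3)])
  finally have WW: "W ** adj W = real_diag d" .
  have "adj W ** W = adj V ** adj M ** (U ** adj U) ** M ** V"
    by (simp add: W_def adj_mult matrix_mul_assoc)
  also have "\<dots> = adj V ** (adj M ** M) ** V"
    by (simp add: U(2) matrix_mul_assoc)
  also have "\<dots> = real_diag e"
    by (rule adj_mult_diagonalisation[OF V(1,3)])
  finally have W'W: "adj W ** W = real_diag e" .
  have "real_diag d ** W = W ** real_diag e"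
    by (metis WW W'W matrix_mul_assoc)
  then have "d i * W $ i $ j = W $ i $ j * e j" for i j
    by (metis mult_real_diag_nth real_diag_mult_nth)
  then have eq: "W $ i $ j = 0 \<or> d i = e j" for i j
    by (metis mult.commute mult_cancel_left of_real_eq_iff)
  have row: "d i = (\<Sum>j\<in>UNIV. (cmod (W $ i $ j))\<^sup>2)" for i
  proof -
    have "complex_of_real (\<Sum>j\<in>UNIV. (cmod (W $ i $ j))\<^sup>2) = (W ** adj W) $ i $ i"
      by (simp add: matrix_mult_nth complex_norm_square del: of_real_power)
    then show ?thesis
      by (simp add: WW real_diag_nth del: of_real_sum of_real_power)
  qed
  have col: "e j = (\<Sum>i\<in>UNIV. (cmod (W $ i $ j))\<^sup>2)" for j
  proof -
    have "complex_of_real (\<Sum>i\<in>UNIV. (cmod (W $ i $ j))\<^sup>2) = (adj W ** W) $ j $ j"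
      by (simp add: matrix_mult_nth complex_norm_square mult.commute del: of_real_power)
    then show ?thesis
      by (simp add: W'W real_diag_nth del: of_real_sum of_real_power)
  qed
  have "(\<Sum>i\<in>UNIV. d i * g (d i)) = (\<Sum>i\<in>UNIV. \<Sum>j\<in>UNIV. (cmod (W $ i $ j))\<^sup>2 * g (d i))"
    by (simp add: row[symmetric] flip: sum_distrib_right)
  also have "\<dots> = (\<Sum>i\<in>UNIV. \<Sum>j\<in>UNIV. (cmod (W $ i $ j))\<^sup>2 * g (e j))"
    using eq by (intro sum.cong refl) (metis mult_zero_left norm_zero power_zero_numeral)
  also have "\<dots> = (\<Sum>j\<in>UNIV. \<Sum>i\<in>UNIV. (cmod (W $ i $ j))\<^sup>2 * g (e j))"
    by (rule sum.swap)
  also have "\<dots> = (\<Sum>j\<in>UNIV. e j * g (e j))"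
    by (simp add: col[symmetric] flip: sum_distrib_right)
  finally show ?thesis .
qed

text \<open>The two spectra have different lengths and agree only up to zeros; these are harmless,
  since every term of the entropy carries its eigenvalue as a factor. The scalar \<open>r\<close>
  leaves room for the later normalisation by the trace.\<close>

lemma vn_entropy_gram:
  fixes M :: "complex ^ 'n ^ 'm"
  shows "vn_entropy (r *\<^sub>R (M ** adj M)) = vn_entropy (r *\<^sub>R transpose (adj M ** M))"
proof -
  obtain U d where Ud: "diagonalisation (M ** adj M) U d"
    using hermitian_diagonalisation[of "M ** adj M"] by (auto simp: adj_mult)
  obtain V e where Ve: "diagonalisation (adj M ** M) V e"
    using hermitian_diagonalisation[of "adj M ** M"] by (auto simp: adj_mult)
  have "vn_entropy (r *\<^sub>R (M ** adj M)) = - (\<Sum>i\<in>UNIV. d i * (r * log 2 (r * d i)))"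
    unfolding vn_entropy_diagonalisation[OF diagonalisation_scaleR[OF Ud]]
    by (simp add: mult.left_commute mult.assoc)
  also have "\<dots> = - (\<Sum>j\<in>UNIV. e j * (r * log 2 (r * e j)))"
    using gram_spectra[OF Ud Ve, of "\<lambda>t. r * log 2 (r * t)"] by (simp only:)
  also have "\<dots> = vn_entropy (r *\<^sub>R transpose (adj M ** M))"
    unfolding vn_entropy_diagonalisation[OF diagonalisation_scaleR[OF diagonalisation_transpose[OF Ve]]]
    by (simp add: mult.left_commute mult.assoc)
  finally show ?thesis .
qed

lemma weighted_entropy_gram:
  fixes M :: "complex ^ 'n ^ 'm"
  shows "weighted_entropy (M ** adj M) = weighted_entropy (transpose (adj M ** M))"
proof -
  have "trace (M ** adj M) = (\<Sum>i\<in>UNIV. \<Sum>j\<in>UNIV. M $ i $ j * cnj (M $ i $ j))"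
    by (simp add: trace_def matrix_mult_nth)
  also have "\<dots> = (\<Sum>j\<in>UNIV. \<Sum>i\<in>UNIV. M $ i $ j * cnj (M $ i $ j))"
    by (rule sum.swap)
  also have "\<dots> = trace (transpose (adj M ** M))"
    by (simp add: trace_def transpose_def matrix_mult_nth mult.commute)
  finally show ?thesis
    by (simp only: weighted_entropy_def vn_entropy_gram[of _ M])
qed

section \<open>Unnormalised post-measurement states\<close>

lemma sum_UNIV_prod:
  "(\<Sum>p\<in>UNIV. f p) = (\<Sum>x\<in>UNIV. \<Sum>y\<in>UNIV. f (x :: 'x::finite, y :: 'y::finite))"
  unfolding sum.cartesian_product by simp

lemma trace_tensor_op:
  "trace (tensor_op (mat 1) F ** \<rho>) = trace (ptrace_snd (tensor_op (mat 1) F ** \<rho>))"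
  by (simp add: trace_def ptrace_snd_def sum_UNIV_prod)

lemma ptrace_snd_tensor_op_nth:
  "ptrace_snd (tensor_op (mat 1) F ** \<rho>) $ x $ x' =
     (\<Sum>b\<in>UNIV. \<Sum>b'\<in>UNIV. F $ b $ b' * \<rho> $ (x, b') $ (x', b))"
proof -
  have "(tensor_op (mat 1) F ** \<rho>) $ (x, b) $ (x', b) =
      (\<Sum>y\<in>UNIV. \<Sum>b'\<in>UNIV. (if x = y then 1 else 0) * F $ b $ b' * \<rho> $ (y, b') $ (x', b))" for b
    by (simp add: matrix_mult_nth tensor_op_def mat_def sum_UNIV_prod)
  also have "(\<Sum>y\<in>UNIV. \<Sum>b'\<in>UNIV. (if x = y then 1 else 0) * F $ b $ b' * \<rho> $ (y, b') $ (x', b)) =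
      (\<Sum>b'\<in>UNIV. F $ b $ b' * \<rho> $ (x, b') $ (x', b))" for b
    by (subst sum.swap) (simp add: if_distrib[of "\<lambda>t. t * _"] cong: if_cong)
  finally show ?thesis
    by (simp add: ptrace_snd_def)
qed

lemma ptrace_snd_tensor_op_sum:
  "ptrace_snd (tensor_op (mat 1) (\<Sum>k\<in>K. F k) ** \<rho>) =
     (\<Sum>k\<in>K. ptrace_snd (tensor_op (mat 1) (F k) ** \<rho>))"
  by (simp add: vec_eq_iff ptrace_snd_tensor_op_nth sum_distrib_right sum.swap[of _ K])

text \<open>An outcome of probability 0 has weighted entropy 0 because of the trace factor, so the
  sum may run over all outcomes. This frees later regroupings from case distinctions.\<close>

lemma measurement_gain_weighted_entropy:
  "measurement_gain \<rho> n E =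
     vn_entropy (ptrace_snd \<rho>) - (\<Sum>i<n. weighted_entropy (ptrace_snd (tensor_op (mat 1) (E i) ** \<rho>)))"
proof -
  have *: "weighted_entropy (ptrace_snd (tensor_op (mat 1) F ** \<rho>)) =
      outcome_prob \<rho> F * vn_entropy (post_state \<rho> F)" for F
    by (simp add: weighted_entropy_def outcome_prob_def post_state_def trace_tensor_op)
  show ?thesis
    unfolding measurement_gain_def * by (auto intro!: sum.mono_neutral_left)
qed

section \<open>Conditional states of a tripartite pure state\<close>

text \<open>
  The operator \<open>slice \<Psi> v\<close> encodes the vector of \<open>A \<otimes> E\<close> left after projecting \<open>B\<close> onto \<open>v\<close>.
\<close>

definition slice ::
  "complex ^ ('a::finite \<times> 'b::finite \<times> 'e::finite) \<Rightarrow> complex ^ 'b \<Rightarrow> complex ^ 'e ^ 'a" where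
  "slice \<Psi> v = (\<chi> a e. \<Sum>b\<in>UNIV. cnj (v $ b) * \<Psi> $ (a, b, e))"

lemma conditional_AB_slice:
  fixes \<Psi> :: "complex ^ ('a::finite \<times> 'b::finite \<times> 'e::finite)"
  shows "ptrace_snd (tensor_op (mat 1) (pure_state v) ** reduced_AB (pure_state \<Psi>)) =
     slice \<Psi> v ** adj (slice \<Psi> v)"
proof -
  have "(\<Sum>b\<in>UNIV. \<Sum>b'\<in>UNIV. v $ b * cnj (v $ b') * (\<Sum>e\<in>UNIV. \<Psi> $ (x, b', e) * cnj (\<Psi> $ (x', b, e)))) =
      (\<Sum>e\<in>UNIV. (\<Sum>b'\<in>UNIV. cnj (v $ b') * \<Psi> $ (x, b', e)) *
        (\<Sum>b\<in>UNIV. v $ b * cnj (\<Psi> $ (x', b, e))))" for x x'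
  proof -
    have "(\<Sum>e\<in>UNIV. (\<Sum>b'\<in>UNIV. cnj (v $ b') * \<Psi> $ (x, b', e)) *
        (\<Sum>b\<in>UNIV. v $ b * cnj (\<Psi> $ (x', b, e)))) =
      (\<Sum>e\<in>UNIV. \<Sum>b\<in>UNIV. \<Sum>b'\<in>UNIV. v $ b * cnj (v $ b') * (\<Psi> $ (x, b', e) * cnj (\<Psi> $ (x', b, e))))"
      by (intro sum.cong refl, subst mult.commute) (simp add: sum_product mult_ac)
    then show ?thesis
      by (simp add: sum_distrib_left sum.swap[of _ "UNIV :: 'e set"])
  qed
  then show ?thesis
    by (simp add: vec_eq_iff ptrace_snd_tensor_op_nth matrix_mult_nth slice_def reduced_AB_def pure_state_def)
qed

text \<open>Symmetry between A and E. Since \<open>reduced_EB\<close> already places B second, the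
  exchange turns one reduction literally into the other, and each result on AB transfers to
  EB.\<close>

definition swap_AE ::
  "complex ^ ('a::finite \<times> 'b::finite \<times> 'e::finite) \<Rightarrow> complex ^ ('e \<times> 'b \<times> 'a)" where
  "swap_AE \<Psi> = (\<chi> p. \<Psi> $ (snd (snd p), fst (snd p), fst p))"

lemma reduced_AB_swap_AE: "reduced_AB (pure_state (swap_AE \<Psi>)) = reduced_EB (pure_state \<Psi>)"
  by (simp add: vec_eq_iff reduced_AB_def reduced_EB_def pure_state_def swap_AE_def)

lemma reduced_EB_swap_AE: "reduced_EB (pure_state (swap_AE \<Psi>)) = reduced_AB (pure_state \<Psi>)"
  by (simp add: vec_eq_iff reduced_AB_def reduced_EB_def pure_state_def swap_AE_def)

lemma conditional_EB_slice:
  "ptrace_snd (tensor_op (mat 1) (pure_state v) ** reduced_EB (pure_state \<Psi>)) =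
     transpose (adj (slice \<Psi> v) ** slice \<Psi> v)"
proof -
  have "slice (swap_AE \<Psi>) v = transpose (slice \<Psi> v)"
    by (simp add: vec_eq_iff slice_def swap_AE_def transpose_def)
  then show ?thesis
    using conditional_AB_slice[of v "swap_AE \<Psi>"]
    by (simp add: reduced_AB_swap_AE vec_eq_iff matrix_mult_nth transpose_def mult.commute)
qed

text \<open>The state vector is cut between AB and E: as a matrix \<open>N\<close> with rows indexed
  by AB and columns by E, its two marginals are the two states compared here.\<close>

lemma vn_entropy_reduced_AB:
  "vn_entropy (reduced_AB (pure_state \<Psi>)) = vn_entropy (ptrace_snd (reduced_EB (pure_state \<Psi>)))"
proof -
  define N where "N = (\<chi> p e. \<Psi> $ (fst p, snd p, e))"
  have "reduced_AB (pure_state \<Psi>) = N ** adj N"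
    by (simp add: vec_eq_iff reduced_AB_def pure_state_def N_def matrix_mult_nth)
  moreover have "ptrace_snd (reduced_EB (pure_state \<Psi>)) $ e $ e' = transpose (adj N ** N) $ e $ e'" for e e'
    unfolding ptrace_snd_def reduced_EB_def pure_state_def N_def matrix_mult_nth transpose_def sum_UNIV_prod
    by (simp add: matrix_mult_nth sum_UNIV_prod mult.commute) (rule sum.swap)
  then have "ptrace_snd (reduced_EB (pure_state \<Psi>)) = transpose (adj N ** N)"
    by (simp add: vec_eq_iff)
  ultimately show ?thesis
    using vn_entropy_gram[of 1 N] by simp
qed

section \<open>Refinement of POVMs to rank-one effects\<close>

lemma psd_sum_pure_states:
  fixes F :: "complex ^ 'b ^ 'b"
  assumes "psd F"
  obtains v where "F = (\<Sum>j<CARD('b). pure_state (v j))"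
proof -
  obtain U d where Ud: "diagonalisation F U d" "\<And>i. 0 \<le> d i"
    using psd_diagonalisation[OF assms] by blast
  \<comment> \<open>Eigenvectors scaled by the roots of their eigenvalues. Zero eigenvalues are kept
    as zero vectors, so every effect splits into exactly \<open>CARD('b)\<close> terms and the
    refined POVM has blocks of equal length.\<close>
  define u where "u k = (\<chi> i. complex_of_real (sqrt (d k)) * U $ i $ k)" for k
  have entry: "pure_state (u k) $ i $ j = U $ i $ k * d k * cnj (U $ j $ k)" for k i j
  proof -
    have "pure_state (u k) $ i $ j =
        complex_of_real (sqrt (d k) * sqrt (d k)) * (U $ i $ k * cnj (U $ j $ k))"
      by (simp only: pure_state_def u_def vec_lambda_beta complex_cnj_mult complex_cnj_complex_of_real
          of_real_mult mult_ac)
    then show ?thesis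
      using Ud(2)[of k] by simp
  qed
  have "F $ i $ j = (\<Sum>k\<in>UNIV. pure_state (u k)) $ i $ j" for i j
    using Ud(1) by (simp add: diagonalisation_def matrix_mult_nth[of _ "adj U"] mult_real_diag_nth entry)
  then have "F = (\<Sum>k\<in>UNIV. pure_state (u k))"
    by (simp add: vec_eq_iff)
  moreover obtain h where h: "bij_betw h {0..<CARD('b)} (UNIV :: 'b set)"
    using ex_bij_betw_nat_finite[of "UNIV :: 'b set"] by auto
  ultimately have "F = (\<Sum>j<CARD('b). pure_state (u (h j)))"
    using sum.reindex_bij_betw[OF h, of "\<lambda>k. pure_state (u k)"] by (simp add: lessThan_atLeast0)
  then show thesis
    by (rule that)
qed

lemma psd_pure_state: "psd (pure_state (v :: complex ^ 'n))"
proof -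
  define M :: "complex ^ unit ^ 'n" where "M = (\<chi> i u. v $ i)"
  have "pure_state v = M ** adj M"
    by (simp add: vec_eq_iff pure_state_def M_def matrix_mult_nth)
  then show ?thesis
    by (simp only: psd_gram)
qed

lemma psd_conditional_AB:
  fixes \<Psi> :: "complex ^ ('a::finite \<times> 'b::finite \<times> 'e::finite)"
  assumes "psd F"
  shows "psd (ptrace_snd (tensor_op (mat 1) F ** reduced_AB (pure_state \<Psi>)))"
proof -
  obtain v where F: "F = (\<Sum>j<CARD('b). pure_state (v j))"
    using psd_sum_pure_states[OF assms] by blast
  show ?thesis
    unfolding F ptrace_snd_tensor_op_sum conditional_AB_slice by (intro psd_sum psd_gram)
qed

lemma povm_refinement:
  fixes E :: "nat \<Rightarrow> complex ^ 'b ^ 'b"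
  assumes "povm n E"
  obtains v where "povm (n * CARD('b)) (\<lambda>m. pure_state (v m))"
    and "\<And>i. i < n \<Longrightarrow> E i = (\<Sum>m\<in>{i * CARD('b)..<i * CARD('b) + CARD('b)}. pure_state (v m))"
proof -
  let ?c = "CARD('b)"
  have "\<forall>i\<in>{..<n}. \<exists>v. E i = (\<Sum>j<?c. pure_state (v j))"
    using assms psd_sum_pure_states by (metis povm_def lessThan_iff)
  then obtain w where w: "\<And>i. i < n \<Longrightarrow> E i = (\<Sum>j<?c. pure_state (w i j))"
    by (metis lessThan_iff)
  \<comment> \<open>The refined outcome \<open>(i, j)\<close> is numbered
    \<open>i * CARD('b) + j\<close>, so quotient and remainder recover the pair.\<close>
  define v where "v m = w (m div ?c) (m mod ?c)" for m
  have E: "E i = (\<Sum>m\<in>{i * ?c..<i * ?c + ?c}. pure_state (v m))" if "i < n" for i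
  proof -
    have "(\<Sum>m\<in>{i * ?c..<i * ?c + ?c}. pure_state (v m)) = (\<Sum>j<?c. pure_state (v (j + i * ?c)))"
      using sum.shift_bounds_nat_ivl[of "\<lambda>m. pure_state (v m)" 0 "i * ?c" ?c]
      by (simp add: add.commute lessThan_atLeast0)
    also have "\<dots> = E i"
      unfolding w[OF that] by (intro sum.cong refl) (simp add: v_def)
    finally show ?thesis by simp
  qed
  have "(\<Sum>m<n * ?c. pure_state (v m)) = (\<Sum>i<n. E i)"
    using sum.nat_group[of "\<lambda>m. pure_state (v m)" ?c n] E by simp
  then have "povm (n * ?c) (\<lambda>m. pure_state (v m))"
    using assms by (simp add: povm_def psd_pure_state)
  with E that show thesis
    by blast
qed

section \<open>Comparison of the two classical correlations\<close>

lemma measurement_gain_AB_le: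
  assumes "povm n E"
  shows "measurement_gain (reduced_AB (pure_state \<Psi>)) n E \<le> vn_entropy (ptrace_snd (reduced_AB (pure_state \<Psi>)))"
proof -
  have "0 \<le> (\<Sum>i<n. weighted_entropy (ptrace_snd (tensor_op (mat 1) (E i) ** reduced_AB (pure_state \<Psi>))))"
    using assms by (intro sum_nonneg weighted_entropy_nonneg psd_conditional_AB) (simp add: povm_def)
  then show ?thesis
    by (simp add: measurement_gain_weighted_entropy)
qed

lemma classical_correlation_AB_upper:
  assumes "povm n E"
  shows "measurement_gain (reduced_AB (pure_state \<Psi>)) n E \<le> classical_correlation (reduced_AB (pure_state \<Psi>))"
  unfolding classical_correlation_def
proof (rule cSup_upper)
  \<comment> \<open>A real supremum bounds its elements only if the set is bounded above; the
    entropy of A is such a bound.\<close>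
  show "bdd_above {measurement_gain (reduced_AB (pure_state \<Psi>)) n E |n E. povm n E}"
    using measurement_gain_AB_le by (intro bdd_aboveI) blast
qed (use assms in blast)

lemma classical_correlation_EB_upper:
  assumes "povm n E"
  shows "measurement_gain (reduced_EB (pure_state \<Psi>)) n E \<le> classical_correlation (reduced_EB (pure_state \<Psi>))"
  using classical_correlation_AB_upper[OF assms, of "swap_AE \<Psi>"] by (simp add: reduced_AB_swap_AE)

text \<open>
  Refining a POVM to rank-one effects does not decrease the gain, and after a rank-one outcome the
  state of \<open>A \<otimes> E\<close> is pure, so that its two marginals have the same entropy.
\<close>

lemma classical_correlation_AB_le_EB:
  fixes \<Psi> :: "complex ^ ('a::finite \<times> 'b::finite \<times> 'e::finite)"
  shows "classical_correlation (reduced_AB (pure_state \<Psi>)) - vn_entropy (ptrace_snd (reduced_AB (pure_state \<Psi>)))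
     \<le> classical_correlation (reduced_EB (pure_state \<Psi>)) - vn_entropy (ptrace_snd (reduced_EB (pure_state \<Psi>)))"
proof -
  let ?AB = "reduced_AB (pure_state \<Psi>)" and ?EB = "reduced_EB (pure_state \<Psi>)" and ?c = "CARD('b)"
  let ?h = "\<lambda>\<rho> F. weighted_entropy (ptrace_snd (tensor_op (mat 1) F ** \<rho>))"
  have gain: "measurement_gain ?AB n E
      \<le> vn_entropy (ptrace_snd ?AB) + (classical_correlation ?EB - vn_entropy (ptrace_snd ?EB))"
    if E: "povm n E" for n E
  proof -
    obtain v where v: "povm (n * ?c) (\<lambda>m. pure_state (v m))"
      and Ei: "\<And>i. i < n \<Longrightarrow> E i = (\<Sum>m\<in>{i * ?c..<i * ?c + ?c}. pure_state (v m))"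
      using povm_refinement[OF E] by blast
    have "(\<Sum>m<n * ?c. ?h ?EB (pure_state (v m))) = (\<Sum>m<n * ?c. ?h ?AB (pure_state (v m)))"
      by (simp add: conditional_AB_slice conditional_EB_slice weighted_entropy_gram)
    also have "\<dots> = (\<Sum>i<n. \<Sum>m\<in>{i * ?c..<i * ?c + ?c}. ?h ?AB (pure_state (v m)))"
      by (rule sum.nat_group[symmetric])
    also have "\<dots> \<le> (\<Sum>i<n. ?h ?AB (E i))"
    proof (rule sum_mono)
      fix i assume "i \<in> {..<n}"
      then have "i < n" by simp
      show "(\<Sum>m\<in>{i * ?c..<i * ?c + ?c}. ?h ?AB (pure_state (v m))) \<le> ?h ?AB (E i)"
        unfolding Ei[OF \<open>i < n\<close>] ptrace_snd_tensor_op_sum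
        by (intro weighted_entropy_superadditive psd_conditional_AB psd_pure_state) simp
    qed
    finally show ?thesis
      using classical_correlation_EB_upper[OF v, of \<Psi>]
      by (simp add: measurement_gain_weighted_entropy)
  qed
  \<comment> \<open>The trivial measurement with one outcome shows that the supremum is taken over a
    nonempty set, as its least-upper-bound property requires.\<close>
  have "adj (mat 1) = (mat 1 :: complex ^ 'b ^ 'b)"
    by (auto simp: vec_eq_iff mat_def)
  then have "povm 1 (\<lambda>_. mat 1 :: complex ^ 'b ^ 'b)"
    using psd_gram[of "mat 1 :: complex ^ 'b ^ 'b"] by (simp add: povm_def)
  then have "{measurement_gain ?AB n E |n E. povm n E} \<noteq> {}"
    by blast
  then have "classical_correlation ?AB
      \<le> vn_entropy (ptrace_snd ?AB) + (classical_correlation ?EB - vn_entropy (ptrace_snd ?EB))"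
    unfolding classical_correlation_def[of ?AB] using gain by (intro cSup_least) auto
  then show ?thesis
    by simp
qed

theorem mainTheorem2:
  fixes \<Psi> :: "complex ^ ('a::finite \<times> 'b::finite \<times> 'e::finite)"
  assumes "norm \<Psi> = 1"
  shows "discord (reduced_AB (pure_state \<Psi>)) + classical_correlation (reduced_EB (pure_state \<Psi>))
           = vn_entropy (reduced_B (pure_state \<Psi>))"
proof -
  have "ptrace_fst (reduced_AB (pure_state \<Psi>)) = reduced_B (pure_state \<Psi>)"
    by (simp add: vec_eq_iff ptrace_fst_def reduced_AB_def reduced_B_def)
  \<comment> \<open>The comparison for \<open>\<Psi>\<close> and for \<open>swap_AE \<Psi>\<close>
    gives opposite inequalities, hence equality. The entropy of AB then cancels that of E, leaving
    the entropy of B.\<close>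
  then show ?thesis
    using classical_correlation_AB_le_EB[of \<Psi>] classical_correlation_AB_le_EB[of "swap_AE \<Psi>"]
    by (simp add: discord_def mutual_information_def vn_entropy_reduced_AB
        reduced_AB_swap_AE reduced_EB_swap_AE)
qed

end
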